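(* Let $K_4^4$ be the radially deformed Fourier kernel in dimension $m=4$ with parameter $a=4$ (see context). For all $z>0$ and $\xi=\cos\theta\in[-1,1]$, $$K_4^4(z,\xi)=e^{-iz^2(\xi^2-1/2)}\left(-2iz\xi\int_{-\infty}^{z\xi}e^{it^2}\,dt+e^{iz^2\xi^2}\right)=e^{iz^2/2}-2iz\cos\theta\,e^{-\frac{i}{2}z^2\cos2\theta}\int_{-\infty}^{z\cos\theta}e^{it^2}\,dt.$$ Furthermore, $K_4^4(z,1)=\mathcal{O}(z)$ as $z\to+\infty$.
   Context: For an integer $m\ge3$ put $\lambda=(m-2)/2$. For $a>0$, $z>0$, $\theta\in[0,\pi]$ and $\xi=\cos\theta$, the radially deformed Fourier kernel (the kernel of $\mathcal{F}_a$ on $\mathbb{R}^m$) is $$K_a^m(z,\xi)=a^{2\lambda/a}\,\Gamma\left(\frac{2\lambda+a}{a}\right)\sum_{k=0}^{\infty}e^{-\frac{i\pi k}{a}}\frac{\lambda+k}{\lambda}z^{-\lambda}J_{\frac{2(k+\lambda)}{a}}\left(\frac{2}{a}z^{a/2}\right)C_k^{(\lambda)}(\xi),$$ where $J_\nu$ is the Bessel function of the first kind and $C_k^{(\lambda)}$ is the Gegenbauer polynomial, $\sum_{k\ge0}C_k^{(\lambda)}(\xi)r^k=(1-2\xi r+r^2)^{-\lambda}$. Here $a=4$, $m=4$, so $\lambda=1$. The integral $\int_{-\infty}^{u}e^{it^2}\,dt$ is a convergent improper integral. *)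

theory Defs
  imports "HOL-Analysis.Analysis" "HOL-Library.Landau_Symbols"
    "HOL-Computational_Algebra.Formal_Power_Series"
begin

text \<open>Bessel function of the first kind, for real order and positive argument (\<open>powr\<close> makes the
  value at \<open>x = 0\<close> equal to \<open>0\<close>). The reciprocal Gamma function \<open>rGamma\<close> vanishes at the poles of
  Gamma, as required by the usual convention for negative integer order.\<close>

definition bessel_J :: "real \<Rightarrow> real \<Rightarrow> real" where
  "bessel_J \<nu> x =
     (\<Sum>n. (-1) ^ n / fact n * rGamma (\<nu> + real n + 1) * (x / 2) powr (2 * real n + \<nu>))"

text \<open>Gegenbauer polynomials as the coefficients of the generating function
  \<open>(1 - 2\<xi>r + r\<^sup>2)\<close> to the power \<open>-\<lambda>\<close>, expanded as a formal power series in \<open>r\<close>: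
  the binomial series \<open>(1 + X)\<close> to the power \<open>-\<lambda>\<close> is composed with \<open>X\<^sup>2 - 2\<xi>X\<close>.\<close>

definition gegenbauer :: "real \<Rightarrow> nat \<Rightarrow> real \<Rightarrow> real" where
  "gegenbauer l k \<xi> =
     fps_nth (fps_compose (fps_binomial (- l)) (fps_X ^ 2 - fps_const (2 * \<xi>) * fps_X)) k"

definition rdf_lambda :: "nat \<Rightarrow> real" where
  "rdf_lambda m = (real m - 2) / 2"

definition rdf_term :: "real \<Rightarrow> nat \<Rightarrow> real \<Rightarrow> real \<Rightarrow> nat \<Rightarrow> complex" where
  "rdf_term a m z \<xi> k = (let l = rdf_lambda m in
     exp (- (\<i> * of_real pi * of_nat k / of_real a)) *
     of_real ((l + real k) / l * z powr (- l) *
       bessel_J (2 * (real k + l) / a) (2 / a * z powr (a / 2)) * gegenbauer l k \<xi>))"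

text \<open>The radially deformed Fourier kernel; meaningful for \<open>m \<ge> 3\<close>, \<open>a > 0\<close>, \<open>z > 0\<close> and
  \<open>\<xi> \<in> {-1..1}\<close>.\<close>

definition rdf_kernel :: "real \<Rightarrow> nat \<Rightarrow> real \<Rightarrow> real \<Rightarrow> complex" where
  "rdf_kernel a m z \<xi> = (let l = rdf_lambda m in
     of_real (a powr (2 * l / a) * Gamma ((2 * l + a) / a)) * (\<Sum>k. rdf_term a m z \<xi> k))"

text \<open>The Henstock--Kurzweil integral over a half-line is the improper integral, also when the
  integrand is not absolutely integrable.\<close>

lemma has_integral_atMost_iff_improper:
  fixes f :: "real \<Rightarrow> complex"
  assumes int: "\<And>b. f integrable_on {b..u}"
  shows "(f has_integral I) {..u} \<longleftrightarrow> ((\<lambda>b. integral {b..u} f) \<longlongrightarrow> I) at_bot"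
proof -
  let ?g = "\<lambda>x. if x \<in> {..u} then f x else 0"
  have eq: "{..u} \<inter> cbox a b = {a..min b u}" for a b by auto
  have g_int: "?g integrable_on cbox a b" for a b
  proof -
    have "f integrable_on {a..min b u}"
      by (rule integrable_on_subinterval[OF int[of a]]) auto
    then show ?thesis
      unfolding integrable_restrict_Int eq .
  qed
  have g_val: "integral (cbox a b) ?g = integral {a..min b u} f" for a b
    unfolding integral_restrict_Int by (simp only: Int_commute[of "cbox a b"] eq)
  have ball: "ball 0 B \<subseteq> cbox a b \<longleftrightarrow> a \<le> - B \<and> B \<le> b" if "B > 0" for a b B :: real
    using that by (simp add: ball_eq_greaterThanLessThan greaterThanLessThan_subseteq_atLeastAtMost_iff)
  have "(f has_integral I) {..u} \<longleftrightarrow>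
    (\<forall>e>0. \<exists>B>0. \<forall>a b. a \<le> - B \<and> B \<le> b \<longrightarrow> norm (integral {a..min b u} f - I) < e)"
    unfolding has_integral_alt' using g_int g_val ball by (simp cong: conj_cong)
  also have "\<dots> \<longleftrightarrow> (\<forall>e>0. \<exists>N. \<forall>a\<le>N. norm (integral {a..u} f - I) < e)"
  proof (intro all_cong1 imp_cong refl iffI)
    fix e :: real
    assume "\<exists>B>0. \<forall>a b. a \<le> - B \<and> B \<le> b \<longrightarrow> norm (integral {a..min b u} f - I) < e"
    then obtain B where B: "\<And>a b. a \<le> - B \<and> B \<le> b \<Longrightarrow> norm (integral {a..min b u} f - I) < e"
      by blast
    have "norm (integral {a..u} f - I) < e" if "a \<le> - B" for a
      using B[of a "max B u"] that by simp
    then show "\<exists>N. \<forall>a\<le>N. norm (integral {a..u} f - I) < e" by blast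
  next
    fix e :: real
    assume "\<exists>N. \<forall>a\<le>N. norm (integral {a..u} f - I) < e"
    then obtain N where N: "\<And>a. a \<le> N \<Longrightarrow> norm (integral {a..u} f - I) < e" by blast
    have "norm (integral {a..min b u} f - I) < e"
      if "a \<le> - (\<bar>N\<bar> + \<bar>u\<bar> + 1)" "\<bar>N\<bar> + \<bar>u\<bar> + 1 \<le> b" for a b
    proof -
      have "a \<le> N" "min b u = u" using that by auto
      then show ?thesis using N by simp
    qed
    moreover have "\<bar>N\<bar> + \<bar>u\<bar> + 1 > 0" by linarith
    ultimately show "\<exists>B>0. \<forall>a b. a \<le> - B \<and> B \<le> b \<longrightarrow> norm (integral {a..min b u} f - I) < e"
      by blast
  qed
  also have "\<dots> \<longleftrightarrow> ((\<lambda>b. integral {b..u} f) \<longlongrightarrow> I) at_bot"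
    by (simp add: tendsto_iff eventually_at_bot_linorder dist_norm)
  finally show ?thesis .
qed

end

theory Submission
  imports Defs "HOL-Probability.Distributions" "HOL-Real_Asymp.Real_Asymp"
    "HOL-Complex_Analysis.Cauchy_Integral_Theorem"
begin

text \<open>
For \<open>a = m = 4\<close> the \<open>k\<close>-th term of the kernel contains a Bessel function of order \<open>(k + 1) / 2\<close> at
\<open>z\<^sup>2 / 2\<close>, whose \<open>n\<close>-th term is a multiple of \<open>z\<close> to the power \<open>4n + k + 1\<close>. After the factor \<open>1 / z\<close> is
absorbed, the kernel is a double series of monomials in \<open>z\<close>. It converges absolutely, so it can be
summed along \<open>4n + k = N\<close>, and the kernel becomes an entire function \<open>h\<close> of \<open>z\<close>
(\<open>rdf_kernel_sums\<close>). Because the phase factor \<open>exp (- \<i> \<pi> / 4)\<close> has fourth power \<open>-1\<close>, it absorbs the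
alternating sign of the Bessel series, and the \<open>N\<close>-th Taylor coefficient is
\<open>exp (- \<i> \<pi> N / 4)\<close> times a real finite sum of multiples of \<open>sin (p \<theta>) / sin \<theta>\<close> with
\<open>p = N + 1 - 4n\<close>.

Multiplication by \<open>2 cos (2 \<theta>)\<close> turns the index \<open>p\<close> into \<open>p + 2\<close> and \<open>p - 2\<close>, and the weights of the
sum are such that the results recombine into a multiple of the sum two degrees higher. This is a two-step
recurrence for the Taylor coefficients (\<open>kernel_coeff_rec\<close>). In even degrees a
boundary term is left over at the end of the summation range; it accounts exactly for the Taylor
coefficients of \<open>exp (\<i> z\<^sup>2 / 2)\<close>. In terms of \<open>h\<close>,
\<open>z h' = (1 - \<i> z\<^sup>2 cos (2 \<theta>)) h - exp (\<i> z\<^sup>2 / 2)\<close> (\<open>kernel_entire_ode\<close>).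

The claimed closed form satisfies the same first-order equation. The equation is singular at the origin,
and its homogeneous solutions are the multiples of \<open>z exp (- \<i> z\<^sup>2 cos (2 \<theta>) / 2)\<close>; so two
solutions agree as soon as their derivatives at \<open>0\<close> agree. For the kernel that derivative is
\<open>sqrt \<pi> exp (- \<i> \<pi> / 4) cos \<theta>\<close>; for the closed form it is \<open>- 2 \<i> cos \<theta>\<close> times the integral of
\<open>exp (\<i> t\<^sup>2)\<close> over the negative half-line. Their equality is the Fresnel integral
\<open>exp (\<i> \<pi> / 4) sqrt \<pi> / 2\<close>, which follows from the Gaussian integral by rotating the ray of
integration (\<open>fresnel_primitive_at_top\<close>).

The growth bound at \<open>\<xi> = 1\<close> holds because the integral over \<open>{..z}\<close> stays bounded
as \<open>z\<close> grows: it converges to the integral over the whole line.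
\<close>

section \<open>Gegenbauer polynomials of parameter one\<close>

text \<open>With parameter one the generating function is the reciprocal of \<open>1 - 2xr + r\<^sup>2\<close>; multiplying by this
  polynomial and comparing coefficients gives the recurrence. The \<open>gegenbauer 1 k\<close> are thus the Chebyshev
  polynomials of the second kind.\<close>

lemma gegenbauer_1:
  shows gegenbauer_1_0: "gegenbauer 1 0 x = 1"
    and gegenbauer_1_Suc_0: "gegenbauer 1 (Suc 0) x = 2 * x"
    and gegenbauer_1_Suc_Suc:
      "gegenbauer 1 (Suc (Suc k)) x = 2 * x * gegenbauer 1 (Suc k) x - gegenbauer 1 k x"
proof -
  define q :: "real fps" where "q = fps_X ^ 2 - fps_const (2 * x) * fps_X"
  define V where "V = fps_compose (fps_binomial (- 1)) q"
  have q0: "fps_nth q 0 = 0"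
    by (simp add: q_def)
  have "(1 + fps_X) * fps_binomial (- 1 :: real) = 1"
    by (simp add: fps_binomial_minus_one inverse_mult_eq_1')
  then have "fps_compose ((1 + fps_X) * fps_binomial (- 1 :: real)) q = fps_compose 1 q"
    by simp
  then have "(1 + q) * V = 1"
    by (simp add: fps_compose_mult_distrib[OF q0] fps_compose_add_distrib q0 V_def)
  then have V: "V = 1 - fps_X ^ 2 * V + fps_const (2 * x) * (fps_X * V)"
    by (simp add: q_def algebra_simps)
  have geg: "gegenbauer 1 k x = fps_nth V k" for k
    by (simp add: gegenbauer_def V_def q_def)
  have coeff: "fps_nth V k = fps_nth (1 - fps_X ^ 2 * V + fps_const (2 * x) * (fps_X * V)) k" for k
    using V by simp
  show 0: "gegenbauer 1 0 x = 1"
    unfolding geg by (subst coeff) (simp add: fps_X_power_mult_nth)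
  show "gegenbauer 1 (Suc 0) x = 2 * x"
    using 0 unfolding geg by (subst coeff) (simp add: fps_X_power_mult_nth)
  show "gegenbauer 1 (Suc (Suc k)) x = 2 * x * gegenbauer 1 (Suc k) x - gegenbauer 1 k x"
    unfolding geg by (subst coeff) (simp add: fps_X_power_mult_nth)
qed

text \<open>Exponential growth in \<open>k\<close> is good enough for all convergence questions below, because the reciprocal
  Gamma factors decay faster; it is read off from the recurrence for every real \<open>x\<close>.\<close>

lemma abs_gegenbauer_1_le: "\<bar>gegenbauer 1 k x\<bar> \<le> (1 + 2 * \<bar>x\<bar>) ^ k"
proof (induction k rule: induct_nat_012)
  case (ge2 k)
  let ?C = "1 + 2 * \<bar>x\<bar>"
  have "\<bar>gegenbauer 1 (Suc (Suc k)) x\<bar>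
      \<le> 2 * \<bar>x\<bar> * \<bar>gegenbauer 1 (Suc k) x\<bar> + \<bar>gegenbauer 1 k x\<bar>"
    using abs_triangle_ineq4[of "2 * x * gegenbauer 1 (Suc k) x" "gegenbauer 1 k x"]
    by (simp add: gegenbauer_1_Suc_Suc abs_mult)
  also have "\<dots> \<le> 2 * \<bar>x\<bar> * ?C ^ Suc k + ?C ^ k"
    using ge2 by (intro add_mono mult_left_mono) auto
  also have "\<dots> \<le> 2 * \<bar>x\<bar> * ?C ^ Suc k + ?C ^ Suc k"
    by (intro add_left_mono power_increasing) auto
  also have "\<dots> = ?C ^ Suc (Suc k)"
    by (simp add: algebra_simps)
  finally show ?case .
qed (simp_all add: gegenbauer_1_0 gegenbauer_1_Suc_0 abs_mult)

text \<open>At \<open>x = cos \<theta>\<close> this is \<open>sin (p \<theta>) / sin \<theta>\<close>. Extending the index to all integers, as an odd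
  function, lets the recurrence run past the end of the summation range without case distinctions.\<close>

definition sine_ratio :: "real \<Rightarrow> int \<Rightarrow> real" where
  "sine_ratio x p = of_int (sgn p) * gegenbauer 1 (nat (\<bar>p\<bar> - 1)) x"

lemma sine_ratio_Suc: "sine_ratio x (int k + 1) = gegenbauer 1 k x"
  by (simp add: sine_ratio_def)

lemma sine_ratio_0 [simp]: "sine_ratio x 0 = 0"
  by (simp add: sine_ratio_def)

lemma sine_ratio_uminus: "sine_ratio x (- p) = - sine_ratio x p"
  by (simp add: sine_ratio_def sgn_minus)

lemma sine_ratio_1: "sine_ratio x 1 = 1"
  by (simp add: sine_ratio_def gegenbauer_1_0)

lemma sine_ratio_step: "sine_ratio x (p + 1) + sine_ratio x (p - 1) = 2 * x * sine_ratio x p"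
proof -
  have pos: "sine_ratio x (int k + 2) + sine_ratio x (int k) = 2 * x * sine_ratio x (int k + 1)" for k
  proof (cases k)
    case 0
    then show ?thesis
      using sine_ratio_Suc[of x 0] sine_ratio_Suc[of x 1]
      by (simp add: gegenbauer_1_0 gegenbauer_1_Suc_0)
  next
    case (Suc m)
    then show ?thesis
      using sine_ratio_Suc[of x m] sine_ratio_Suc[of x "m + 1"] sine_ratio_Suc[of x "m + 2"]
      by (simp add: gegenbauer_1_Suc_Suc add_ac)
  qed
  consider k where "p = int k + 1" | "p = 0" | k where "p = - (int k + 1)"
    by (metis add.commute int_cases of_nat_Suc zadd_int_left of_nat_0 not0_implies_Suc)
  then show ?thesis
  proof cases
    case 1
    then show ?thesis using pos[of k] by (simp add: add_ac)
  next
    case 2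
    then show ?thesis using sine_ratio_uminus[of x 1] by simp
  next
    case 3
    then have "p + 1 = - int k" "p - 1 = - (int k + 2)" by simp_all
    then show ?thesis using pos[of k] 3 by (simp only: sine_ratio_uminus)
  qed
qed

text \<open>The identity \<open>sin ((p + 2) \<theta>) + sin ((p - 2) \<theta>) = 2 cos (2 \<theta>) sin (p \<theta>)\<close>.\<close>

lemma sine_ratio_double_step:
  "sine_ratio x (p + 2) + sine_ratio x (p - 2) = 2 * (2 * x\<^sup>2 - 1) * sine_ratio x p"
proof -
  have up: "sine_ratio x (p + 2) + sine_ratio x p = 2 * x * sine_ratio x (p + 1)"
    using sine_ratio_step[of x "p + 1"] by (simp add: add_ac)
  have down: "sine_ratio x p + sine_ratio x (p - 2) = 2 * x * sine_ratio x (p - 1)"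
    using sine_ratio_step[of x "p - 1"] by simp
  have "sine_ratio x (p + 2) + sine_ratio x (p - 2)
      = 2 * x * (sine_ratio x (p + 1) + sine_ratio x (p - 1)) - 2 * sine_ratio x p"
    using up down by (simp add: algebra_simps)
  also have "\<dots> = 2 * (2 * x\<^sup>2 - 1) * sine_ratio x p"
    unfolding sine_ratio_step by (simp add: power2_eq_square algebra_simps)
  finally show ?thesis .
qed

section \<open>The recurrence for the Taylor coefficients of the kernel\<close>

text \<open>The term with indices \<open>k = M - 4n\<close> and \<open>n\<close> of the double series has degree \<open>M\<close>. Up to sign and
  normalisation, its factors \<open>k + 1\<close>, \<open>1 / n!\<close> and \<open>1 / \<Gamma> ((k + 1) / 2 + n + 1)\<close> multiply to this weight.
  The formula makes sense also for \<open>4n > M\<close>.\<close>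

definition bessel_weight :: "nat \<Rightarrow> nat \<Rightarrow> real" where
  "bessel_weight M n = (real M + 1 - 4 * real n) / fact n * rGamma ((real M + 3) / 2 - real n)"

lemma bessel_weight_step_0: "(real M + 1) / 2 * bessel_weight (M + 2) 0 = bessel_weight M 0"
proof -
  have "rGamma ((real M + 3) / 2) = (real M + 3) / 2 * rGamma ((real M + 5) / 2)"
  proof -
    have "(real M + 3) / 2 + 1 = (real M + 5) / 2" by simp
    then show ?thesis using rGamma_plus1[of "(real M + 3) / 2"] by metis
  qed
  then show ?thesis
    by (simp add: bessel_weight_def add_ac)
qed

text \<open>With \<open>y = (M + 1) / 2 - n\<close>, all three Gamma factors reduce to \<open>1 / \<Gamma> (y + 1)\<close>, and a polynomial identity
  in \<open>M\<close> and \<open>n\<close> remains. The factor \<open>M + 1\<close> produced here is the one that differentiation in \<open>z\<close>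
  contributes to the differential equation.\<close>

lemma bessel_weight_step:
  "(real M + 1) / 2 * bessel_weight (M + 2) (Suc n) = bessel_weight M (Suc n) + bessel_weight M n"
proof -
  define y where "y = (real M + 1) / 2 - real n"
  have M: "real M = 2 * y + 2 * real n - 1"
    by (simp add: y_def field_simps)
  have args: "(real (M + 2) + 3) / 2 - real (Suc n) = y + 1"
    "(real M + 3) / 2 - real (Suc n) = y" "(real M + 3) / 2 - real n = y + 1"
    by (simp_all add: y_def field_simps)
  show ?thesis
    unfolding bessel_weight_def args rGamma_plus1[of y, symmetric]
    by (simp add: M divide_simps) (simp add: algebra_simps)
qed

text \<open>Multiplication by \<open>2 cos (2 \<theta>)\<close> sends the \<open>n\<close>-th summand to the indices belonging to \<open>n\<close> and \<open>n + 1\<close> in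
  degree \<open>M + 2\<close>. By \<open>bessel_weight_step\<close> the two contributions to each index add up to the weight of
  degree \<open>M + 2\<close>, except that the second contribution of the last summand has no partner.\<close>

lemma sum_bessel_weight_telescope:
  "2 * (2 * x\<^sup>2 - 1) * (\<Sum>n\<le>T. bessel_weight M n * sine_ratio x (int M + 1 - 4 * int n)) =
     (real M + 1) / 2 *
       (\<Sum>n\<le>T. bessel_weight (M + 2) n * sine_ratio x (int M + 3 - 4 * int n)) +
     bessel_weight M T * sine_ratio x (int M - 1 - 4 * int T)"
proof (induction T)
  case 0
  have "2 * (2 * x\<^sup>2 - 1) * (bessel_weight M 0 * sine_ratio x (int M + 1)) =
    bessel_weight M 0 * (sine_ratio x (int M + 1 + 2) + sine_ratio x (int M + 1 - 2))"
    by (simp only: sine_ratio_double_step mult_ac)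
  moreover have "(1 + real M) * bessel_weight (Suc (Suc M)) 0 = bessel_weight M 0 * 2"
    using bessel_weight_step_0[of M] by (simp add: add.commute)
  ultimately show ?case
    by (simp add: distrib_left add.commute)
next
  case (Suc T)
  let ?p = "int M + 1 - 4 * int (Suc T)"
  have step: "2 * (2 * x\<^sup>2 - 1) * (bessel_weight M (Suc T) * sine_ratio x ?p) =
    bessel_weight M (Suc T) * (sine_ratio x (?p + 2) + sine_ratio x (?p - 2))"
    by (simp only: sine_ratio_double_step mult_ac)
  have idx: "int M + 3 - 4 * int (Suc T) = ?p + 2" "int M - 1 - 4 * int (Suc T) = ?p - 2"
    "int M - 1 - 4 * int T = ?p + 2"
    by simp_all
  have weight: "(real M + 1) / 2 * (bessel_weight (M + 2) (Suc T) * y) =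
    (bessel_weight M (Suc T) + bessel_weight M T) * y" for y
    by (simp only: mult.assoc [symmetric] bessel_weight_step)
  show ?case
    unfolding sum.atMost_Suc distrib_left Suc.IH step idx weight by (simp add: algebra_simps)
qed

definition angular_coeff :: "real \<Rightarrow> nat \<Rightarrow> real" where
  "angular_coeff x M =
     (\<Sum>n\<le>M div 4. bessel_weight M n * sine_ratio x (int M + 1 - 4 * int n))"

text \<open>Legendre's duplication formula at integers; it identifies the boundary terms of the recurrence with
  coefficients of an exponential series.\<close>

lemma rGamma_three_halves:
  "rGamma (real T + 3 / 2) / fact T = 2 ^ (2 * T + 1) / (sqrt pi * fact (2 * T + 1))"
proof (induction T)
  case 0
  have "rGamma (1 / 2 :: real) = 1 / 2 * rGamma (3 / 2)"
    using rGamma_plus1[of "1/2 :: real"] by simp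
  moreover have "rGamma (1 / 2 :: real) = 1 / sqrt pi"
    by (simp add: rGamma_inverse_Gamma Gamma_one_half_real field_simps)
  ultimately show ?case by simp
next
  case (Suc T)
  have "rGamma (real T + 3 / 2) = (real T + 3 / 2) * rGamma (real (Suc T) + 3 / 2)"
    using rGamma_plus1[of "real T + 3 / 2"] by (simp add: add_ac)
  then have "rGamma (real (Suc T) + 3 / 2) / fact (Suc T) =
      rGamma (real T + 3 / 2) / fact T / ((real T + 3 / 2) * real (Suc T))"
    by (simp add: add_nonneg_eq_0_iff)
  also have "\<dots> = 2 ^ (2 * Suc T + 1) / (sqrt pi * fact (2 * Suc T + 1))"
    unfolding Suc.IH by (simp add: divide_simps) (simp add: algebra_simps)
  finally show ?case .
qed

text \<open>The upper limit \<open>M div 4\<close> makes the last index \<open>p = M + 1 - 4n\<close> one of 1, 2, 3, 4. For the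
  values 2 and 4 (odd \<open>M\<close>) what is left over or missing at the boundary carries index 0 and vanishes. For
  the values 1 and 3 (even \<open>M\<close>) it carries an index of absolute value 1 and yields the inhomogeneity.\<close>

lemma angular_coeff_rec:
  "(real M + 1) * angular_coeff x (M + 2) = 4 * (2 * x\<^sup>2 - 1) * angular_coeff x M +
     (if even M then 4 * (- 2) ^ (M div 2) / (sqrt pi * fact (M div 2 + 1)) else 0)"
proof -
  define T where "T = M div 4"
  note tele = sum_bessel_weight_telescope[of x M]
  have idx: "int (M + 2) + 1 - 4 * int n = int M + 3 - 4 * int n" for n
    by simp
  have double: "2 * (2 * x\<^sup>2 - 1) * sine_ratio x (- 1) - sine_ratio x (- 3) = 1"
    using sine_ratio_double_step[of x "- 1"] sine_ratio_1[of x] by simp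
  have "M mod 4 < 4" by simp
  then consider "M = 4 * T" | "M = 4 * T + 1" | "M = 4 * T + 2" | "M = 4 * T + 3"
    unfolding T_def by linarith
  then show ?thesis
  proof cases
    case 1
    have top: "(M + 2) div 4 = T" "M div 4 = T" "M div 2 = 2 * T" "even M" using 1 by auto
    have w: "bessel_weight M T = 2 ^ (2 * T + 1) / (sqrt pi * fact (2 * T + 1))"
      using rGamma_three_halves[of T] 1
      by (simp add: bessel_weight_def add_divide_distrib)
    have p: "int M - 1 - 4 * int T = - 1" using 1 by simp
    have "(real M + 1) * angular_coeff x (M + 2) = 4 * (2 * x\<^sup>2 - 1) * angular_coeff x M +
      2 * bessel_weight M T"
      using tele[of T] unfolding angular_coeff_def top(1,2) idx p
      by (simp add: sine_ratio_uminus sine_ratio_1 field_simps)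
    then show ?thesis
      unfolding w by (simp add: top)
  next
    case 2
    have top: "(M + 2) div 4 = T" "M div 4 = T" "odd M" using 2 by auto
    have p: "int M - 1 - 4 * int T = 0" using 2 by simp
    show ?thesis
      using tele[of T] unfolding angular_coeff_def top(1,2) idx p
      by (simp add: field_simps top(3))
  next
    case 3
    have top: "(M + 2) div 4 = Suc T" "M div 4 = T" "M div 2 = 2 * T + 1" "even M" using 3 by auto
    have w: "bessel_weight M (Suc T) = - (2 ^ (2 * T + 2) / (sqrt pi * fact (2 * T + 2)))"
    proof -
      have "bessel_weight M (Suc T) = - (rGamma (real T + 3 / 2) / fact T / real (Suc T))"
        using 3 by (simp add: bessel_weight_def add_divide_distrib add.commute mult.commute)
      also have "\<dots> = - (2 ^ (2 * T + 2) / (sqrt pi * fact (2 * T + 2)))"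
        unfolding rGamma_three_halves by (simp add: divide_simps)
      finally show ?thesis .
    qed
    \<comment> \<open>The sum of degree \<open>M + 2\<close> has one summand more than the sum of degree \<open>M\<close>, so the
      telescoped identity is used with the additional summand of index \<open>-1\<close>, which is then moved to the
      other side.\<close>
    have p: "int M - 1 - 4 * int (Suc T) = - 3" "int M + 1 - 4 * int (Suc T) = - 1" using 3 by simp_all
    have "2 * (2 * x\<^sup>2 - 1) * angular_coeff x M =
      (real M + 1) / 2 * angular_coeff x (M + 2) - bessel_weight M (Suc T) *
        (2 * (2 * x\<^sup>2 - 1) * sine_ratio x (- 1) - sine_ratio x (- 3))"
      using tele[of "Suc T"] unfolding sum.atMost_Suc[of _ T] p angular_coeff_def top(1,2) idx
      by (simp add: algebra_simps)
    then have "(real M + 1) * angular_coeff x (M + 2) = 4 * (2 * x\<^sup>2 - 1) * angular_coeff x M +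
      2 * bessel_weight M (Suc T)"
      unfolding double by (simp add: field_simps)
    then show ?thesis
      unfolding w by (simp add: top)
  next
    case 4
    have top: "(M + 2) div 4 = Suc T" "M div 4 = T" "odd M" using 4 by auto
    \<comment> \<open>The summand that is added to match the longer sum has index 0.\<close>
    have w: "bessel_weight M (Suc T) = 0" using 4 by (simp add: bessel_weight_def)
    show ?thesis
      using tele[of "Suc T"] unfolding angular_coeff_def top(1,2) idx
      by (simp add: w field_simps top(3))
  qed
qed

definition phase :: complex where
  "phase = exp (- (\<i> * of_real pi / 4))"

lemma phase_power2: "phase ^ 2 = - \<i>"
proof -
  have "phase ^ 2 = cis (- (pi / 2))"
    by (simp add: phase_def exp_of_nat_mult [symmetric] cis_conv_exp mult_ac)
  then show ?thesis by (simp add: cis.ctr complex_eq_iff)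
qed

text \<open>The Taylor coefficients in \<open>z\<close>: the weights come with powers of \<open>z / 2\<close>, and the factor \<open>sqrt pi / 2\<close>
  is the normalisation \<open>a powr (2 \<lambda> / a) * \<Gamma> ((2 \<lambda> + a) / a) = sqrt pi\<close> of the kernel combined with the
  factor \<open>1 / 2\<close> that remains when \<open>1 / z\<close> is absorbed into the powers of \<open>z / 2\<close>.\<close>

definition kernel_coeff :: "real \<Rightarrow> nat \<Rightarrow> complex" where
  "kernel_coeff x N = of_real (sqrt pi / 2 * angular_coeff x N) * (phase / 2) ^ N"

lemma kernel_coeff_0: "kernel_coeff x 0 = 1"
  using rGamma_three_halves[of 0]
  by (simp add: kernel_coeff_def angular_coeff_def bessel_weight_def sine_ratio_1)

lemma Gamma_two: "Gamma (2 :: real) = 1"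
  using Gamma_fact[of 1, where ?'a = real] by simp

lemma kernel_coeff_1: "kernel_coeff x 1 = of_real (sqrt pi * x) * phase"
  using sine_ratio_Suc[of x 1]
  by (simp add: kernel_coeff_def angular_coeff_def bessel_weight_def gegenbauer_1_Suc_0 rGamma_inverse_Gamma Gamma_two)

lemma kernel_coeff_rec:
  "of_nat (M + 1) * kernel_coeff x (M + 2) = - \<i> * of_real (2 * x\<^sup>2 - 1) * kernel_coeff x M -
     (if even M then (\<i> / 2) ^ (M div 2 + 1) / fact (M div 2 + 1) else 0)"
proof -
  have p2: "(phase / 2) ^ 2 = - \<i> / 4"
    by (simp add: power_divide phase_power2)
  define B :: real where
    "B = (if even M then 4 * (- 2) ^ (M div 2) / (sqrt pi * fact (M div 2 + 1)) else 0)"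
  have inhomogeneity: "of_real (sqrt pi / 2 * B) * (phase / 2) ^ M * (\<i> / 4) =
    (if even M then (\<i> / 2) ^ (M div 2 + 1) / fact (M div 2 + 1) else 0)"
  proof (cases "even M")
    case True
    define j where "j = M div 2"
    have M: "M = 2 * j" using True by (simp add: j_def)
    have pw: "(- 2) ^ j * (- \<i> / 4) ^ j = (\<i> / 2) ^ j"
      by (simp flip: power_mult_distrib)
    have "sqrt pi / 2 * B = 2 * (- 2) ^ j / fact (j + 1)"
      by (simp add: B_def M del: fact_Suc)
    then have "of_real (sqrt pi / 2 * B) * (phase / 2) ^ M * (\<i> / 4) =
      of_real (2 * (- 2) ^ j / fact (j + 1)) * (- \<i> / 4) ^ j * (\<i> / 4)"
      unfolding M power_mult p2 by (simp only:)
    also have "\<dots> = (- 2) ^ j * (- \<i> / 4) ^ j * (\<i> / 2) / fact (j + 1)"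
      by (simp del: fact_Suc)
    finally show ?thesis unfolding pw by (simp add: M)
  qed (simp add: B_def)
  have "of_nat (M + 1) * kernel_coeff x (M + 2)
      = of_real (sqrt pi / 2 * ((real M + 1) * angular_coeff x (M + 2))) * (phase / 2) ^ M * (- \<i> / 4)"
    by (simp only: kernel_coeff_def power_add p2) simp
  also have "\<dots> = - \<i> * of_real (2 * x\<^sup>2 - 1) * kernel_coeff x M -
    of_real (sqrt pi / 2 * B) * (phase / 2) ^ M * (\<i> / 4)"
    unfolding angular_coeff_rec B_def [symmetric] by (simp add: kernel_coeff_def algebra_simps)
  also note inhomogeneity
  finally show ?thesis .
qed

section \<open>The kernel as a power series\<close>

lemma rGamma_real_nonneg: "0 < y \<Longrightarrow> 0 \<le> rGamma (y :: real)"
  by (simp add: rGamma_inverse_Gamma less_imp_le)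

text \<open>Both parities of \<open>k\<close> are covered by one induction in steps of two: the functional equation contributes
  \<open>(k + 3) / 2\<close>, which is at least \<open>k div 2 + 1\<close>.\<close>

lemma rGamma_half_integer_le: "rGamma (real k / 2 + 3 / 2) \<le> 2 / fact (k div 2)"
proof (induction k rule: induct_nat_012)
  case 0
  have "2 / sqrt pi \<le> (2 :: real)"
    using pi_gt3 by (simp add: divide_le_eq)
  then show ?case using rGamma_three_halves[of 0] by simp
next
  case 1
  show ?case by (simp add: rGamma_inverse_Gamma Gamma_two)
next
  case (ge2 k)
  let ?y = "real k / 2 + 3 / 2"
  have "?y * rGamma (?y + 1) = rGamma ?y"
    by (rule rGamma_plus1)
  then have "?y * rGamma (?y + 1) \<le> 2 / fact (k div 2)"
    using ge2 by simp
  moreover have "real (k div 2) + 1 \<le> ?y"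
    by linarith
  moreover have "0 \<le> rGamma (?y + 1)"
    by (intro rGamma_real_nonneg) (simp add: add_nonneg_pos)
  ultimately have "(real (k div 2) + 1) * rGamma (?y + 1) \<le> 2 / fact (k div 2)"
    by (meson mult_right_mono order_trans)
  then have "rGamma (?y + 1) \<le> 2 / fact (k div 2) / (real (k div 2) + 1)"
    by (subst pos_le_divide_eq) (simp_all add: mult.commute add_nonneg_pos)
  moreover have "real (Suc (Suc k)) / 2 + 3 / 2 = ?y + 1"
    by (simp add: add_divide_distrib)
  ultimately show ?case
    by (simp add: mult.commute add.commute)
qed

lemma rGamma_add_nat_le:
  assumes "1 \<le> y"
  shows "rGamma (y + real n) \<le> rGamma y"
proof (induction n)
  case (Suc n)
  have "1 * rGamma (y + real n + 1) \<le> (y + real n) * rGamma (y + real n + 1)"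
    using assms by (intro mult_right_mono rGamma_real_nonneg) auto
  also have "\<dots> = rGamma (y + real n)"
    by (rule rGamma_plus1)
  finally show ?case using Suc by (simp add: add_ac)
qed simp

lemma summable_power_div_fact_half:
  fixes r :: real
  shows "summable (\<lambda>k. r ^ k / fact (k div 2))"
proof -
  have s: "(\<lambda>j. (r\<^sup>2) ^ j / fact j) sums exp (r\<^sup>2)"
    using exp_converges[of "r\<^sup>2"] by (simp add: divide_inverse mult.commute)
  have "(\<lambda>k. if even k then (r\<^sup>2) ^ (k div 2) / fact (k div 2)
      else r * ((r\<^sup>2) ^ ((k - 1) div 2) / fact ((k - 1) div 2))) sums (r * exp (r\<^sup>2) + exp (r\<^sup>2))"
    by (rule sums_if[OF sums_mult[OF s] s])
  moreover have "(if even k then (r\<^sup>2) ^ (k div 2) / fact (k div 2)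
      else r * ((r\<^sup>2) ^ ((k - 1) div 2) / fact ((k - 1) div 2))) = r ^ k / fact (k div 2)" for k
    by (auto elim!: evenE oddE simp flip: power_mult)
  ultimately show ?thesis
    by (simp add: sums_iff)
qed

text \<open>The summand of the kernel obtained from the \<open>n\<close>-th term of the Bessel series in the \<open>k\<close>-th term, without
  the normalising factor \<open>sqrt pi\<close>.\<close>

definition kernel_double_term :: "real \<Rightarrow> real \<Rightarrow> nat \<times> nat \<Rightarrow> complex" where
  "kernel_double_term z x = (\<lambda>(k, n). phase ^ k * of_real ((real k + 1) / 2 * ((- 1) ^ n / fact n) *
     rGamma (real k / 2 + 3 / 2 + real n) * (z / 2) ^ (4 * n + k) * gegenbauer 1 k x))"

lemma norm_phase: "norm phase = 1"
  by (simp add: phase_def)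

text \<open>The bound separates \<open>k\<close> and \<open>n\<close>, so that absolute summability follows from two single series. The
  linear factor \<open>k + 1\<close> is absorbed in \<open>2 ^ k\<close>.\<close>

lemma norm_kernel_double_term_le:
  assumes "z > 0"
  shows "norm (kernel_double_term z x (k, n)) \<le>
    ((1 + 2 * \<bar>x\<bar>) * z) ^ k / fact (k div 2) * (((z / 2) ^ 4) ^ n / fact n)"
proof -
  let ?G = "rGamma (real k / 2 + 3 / 2 + real n)"
  have G0: "0 \<le> ?G" by (intro rGamma_real_nonneg) auto
  have G: "?G \<le> 2 / fact (k div 2)"
    using rGamma_add_nat_le[of "real k / 2 + 3 / 2" n] rGamma_half_integer_le[of k] by simp
  have "real k + 1 \<le> 2 ^ k"
    using less_exp[of k] by (metis Suc_leI of_nat_Suc of_nat_le_iff of_nat_numeral of_nat_power add.commute)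
  then have k: "(real k + 1) / 2 \<le> 2 ^ k / 2"
    by simp
  have "norm (kernel_double_term z x (k, n)) =
      (real k + 1) / 2 * (1 / fact n) * ?G * (z / 2) ^ (4 * n + k) * \<bar>gegenbauer 1 k x\<bar>"
    using G0 assms
    unfolding kernel_double_term_def prod.case norm_mult norm_power norm_phase norm_of_real
    by (simp add: abs_mult power_abs)
  also have "\<dots> \<le>
      2 ^ k / 2 * (1 / fact n) * (2 / fact (k div 2)) * (z / 2) ^ (4 * n + k) * (1 + 2 * \<bar>x\<bar>) ^ k"
    using assms by (intro mult_mono k G abs_gegenbauer_1_le) (auto intro!: mult_nonneg_nonneg G0)
  also have "\<dots> = ((1 + 2 * \<bar>x\<bar>) * z) ^ k / fact (k div 2) * (((z / 2) ^ 4) ^ n / fact n)"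
    by (simp add: power_add power_mult power_mult_distrib power_divide) (simp add: mult_ac)
  finally show ?thesis .
qed

lemma kernel_double_term_summable:
  assumes "z > 0"
  shows "kernel_double_term z x summable_on UNIV"
proof -
  define A B where "A = (\<lambda>k. ((1 + 2 * \<bar>x\<bar>) * z) ^ k / fact (k div 2))"
    and "B = (\<lambda>n. ((z / 2) ^ 4) ^ n / fact n)"
  have nonneg: "0 \<le> A k" "0 \<le> B n" for k n
    unfolding A_def B_def using assms
    by (intro divide_nonneg_nonneg zero_le_power mult_nonneg_nonneg; simp)+
  have "summable A"
    unfolding A_def by (rule summable_power_div_fact_half)
  moreover have "summable B"
    using summable_exp[of "(z / 2) ^ 4"] unfolding B_def by (simp only: divide_inverse mult.commute)
  ultimately have AB: "A summable_on UNIV" "B summable_on UNIV"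
    using nonneg by (simp_all add: summable_on_UNIV_nonneg_real_iff)
  have "(\<lambda>kn. norm (case kn of (k, n) \<Rightarrow> A k * B n)) summable_on (UNIV \<times> UNIV)"
    unfolding Infinite_Sum.abs_summable_on_Sigma_iff using nonneg AB
    by (auto simp: abs_mult infsum_cmult_right' infsum_nonneg intro!: summable_on_cmult_right summable_on_cmult_left)
  then have "(\<lambda>kn. norm (kernel_double_term z x kn)) summable_on (UNIV \<times> UNIV)"
  proof (rule Infinite_Sum.abs_summable_on_comparison_test)
    fix kn :: "nat \<times> nat"
    obtain k n where kn: "kn = (k, n)" by fastforce
    have "norm (kernel_double_term z x (k, n)) \<le> A k * B n"
      unfolding A_def B_def by (rule norm_kernel_double_term_le[OF assms])
    also have "\<dots> \<le> norm (A k * B n)"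
      by simp
    finally show "norm (kernel_double_term z x kn) \<le> norm (case kn of (k, n) \<Rightarrow> A k * B n)"
      by (simp only: kn prod.case)
  qed
  then show ?thesis
    using abs_summable_summable by fastforce
qed

lemma kernel_double_term_sums_rdf_term:
  assumes "z > 0"
  shows "((\<lambda>n. kernel_double_term z x (k, n)) has_sum rdf_term 4 4 z x k) UNIV"
proof -
  let ?b = "\<lambda>n. (- 1) ^ n / fact n * rGamma ((real k + 1) / 2 + real n + 1) *
    (z\<^sup>2 / 2 / 2) powr (2 * real n + (real k + 1) / 2)"
  have pw: "(z\<^sup>2 / 2 / 2) powr (2 * real n + (real k + 1) / 2) = (z / 2) ^ (4 * n + k + 1)" for n
  proof -
    have "z\<^sup>2 / 2 / 2 = (z / 2) powr 2"
      using assms by (simp add: power_divide)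
    then have "(z\<^sup>2 / 2 / 2) powr (2 * real n + (real k + 1) / 2) = (z / 2) powr real (4 * n + k + 1)"
      by (simp only: powr_powr) (rule arg_cong[where f = "(powr) (z / 2)"], simp add: field_simps)
    also have "\<dots> = (z / 2) ^ (4 * n + k + 1)"
      using assms by (intro powr_realpow) simp
    finally show ?thesis .
  qed
  have arg: "(real k + 1) / 2 + real n + 1 = real k / 2 + 3 / 2 + real n" for n
    by (simp add: field_simps)
  have term_eq: "kernel_double_term z x (k, n) =
    phase ^ k * of_real ((real k + 1) * z powr (- 1) * gegenbauer 1 k x) * of_real (?b n)" for n
  proof -
    define W where "W = (z / 2) ^ (4 * n + k + 1)"
    have W: "(z / 2) ^ (4 * n + k) = 2 * z powr (- 1) * W"
      using assms by (simp add: W_def powr_minus)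
    have rearrange: "a / 2 * (s / f) * G * (2 * p * W) * g = (a * p * g) * (s / f * G * W)"
      for a s f G p g :: real
      by simp
    show ?thesis
      unfolding pw arg kernel_double_term_def prod.case W W_def [symmetric] rearrange
      by (simp only: of_real_mult mult.assoc)
  qed
  have "summable ?b"
  proof (rule summable_comparison_test')
    show "summable (\<lambda>n. rGamma (real k / 2 + 3 / 2) * (z / 2) ^ (k + 1) * (((z / 2) ^ 4) ^ n / fact n))"
      by (rule summable_mult) (use summable_exp[of "(z / 2) ^ 4"] in \<open>simp only: divide_inverse mult.commute\<close>)
    fix n :: nat
    have "0 \<le> rGamma (real k / 2 + 3 / 2 + real n)" by (intro rGamma_real_nonneg) auto
    moreover have "rGamma (real k / 2 + 3 / 2 + real n) \<le> rGamma (real k / 2 + 3 / 2)"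
      by (rule rGamma_add_nat_le) simp
    ultimately have "\<bar>rGamma (real k / 2 + 3 / 2 + real n)\<bar> * ((z / 2) ^ (4 * n + k + 1) / fact n) \<le>
        rGamma (real k / 2 + 3 / 2) * ((z / 2) ^ (4 * n + k + 1) / fact n)"
      using assms by (intro mult_right_mono) auto
    then show "norm (?b n) \<le> rGamma (real k / 2 + 3 / 2) * (z / 2) ^ (k + 1) * (((z / 2) ^ 4) ^ n / fact n)"
      using assms unfolding pw arg
      by (simp add: abs_mult power_abs power_add power_mult) (simp add: mult_ac)
  qed
  then have "?b sums bessel_J ((real k + 1) / 2) (z\<^sup>2 / 2)"
    unfolding bessel_J_def by (rule summable_sums)
  then have "(\<lambda>n. kernel_double_term z x (k, n)) sums
    (phase ^ k * of_real ((real k + 1) * z powr (- 1) * gegenbauer 1 k x) *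
      of_real (bessel_J ((real k + 1) / 2) (z\<^sup>2 / 2)))"
    unfolding term_eq by (intro sums_mult sums_of_real)
  also have "phase ^ k * of_real ((real k + 1) * z powr (- 1) * gegenbauer 1 k x) *
      of_real (bessel_J ((real k + 1) / 2) (z\<^sup>2 / 2)) = rdf_term 4 4 z x k"
  proof -
    have ph: "phase ^ k = exp (- (\<i> * of_real pi * of_nat k / of_real 4))"
      by (simp add: phase_def exp_of_nat_mult [symmetric] mult_ac)
    have args: "2 * (real k + 1) / 4 = (real k + 1) / 2" "2 / 4 * z powr (4 / 2) = z\<^sup>2 / 2"
      "(real 4 - 2) / 2 = 1"
      using assms by simp_all
    show ?thesis
      unfolding rdf_term_def rdf_lambda_def Let_def args ph by (simp add: mult_ac)
  qed
  finally have sums: "(\<lambda>n. kernel_double_term z x (k, n)) sums rdf_term 4 4 z x k" .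
  have "(\<lambda>n. kernel_double_term z x (k, n)) summable_on UNIV"
    using kernel_double_term_summable[OF assms, of x]
      summable_on_SigmaD1[of "\<lambda>k n. kernel_double_term z x (k, n)" UNIV "\<lambda>_. UNIV" k]
    by simp
  with sums show ?thesis
    by (metis has_sum_imp_sums has_sum_infsum sums_unique2)
qed

text \<open>The sign \<open>(-1) ^ n\<close> of the Bessel series disappears here: since \<open>phase ^ 4 = -1\<close>, it combines with
  \<open>phase ^ (N - 4n)\<close> to \<open>phase ^ N\<close>, which is constant along the antidiagonal.\<close>

lemma sum_kernel_double_term_antidiagonal:
  "of_real (sqrt pi) * (\<Sum>n\<le>N div 4. kernel_double_term z x (N - 4 * n, n)) =
    kernel_coeff x N * of_real z ^ N"
proof -
  have "phase ^ 4 = -1"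
    using power_mult[of phase 2 2] by (simp add: phase_power2)
  then have ph: "phase ^ N = phase ^ (N - 4 * n) * of_real ((- 1) ^ n)" if "n \<le> N div 4" for n
    using that power_add[of phase "N - 4 * n" "4 * n"] by (simp add: power_mult)
  have antidiagonal: "kernel_double_term z x (N - 4 * n, n) = phase ^ N / 2 * of_real ((z / 2) ^ N) *
      of_real (bessel_weight N n * sine_ratio x (int N + 1 - 4 * int n))" if n: "n \<le> N div 4" for n
  proof -
    from n have le: "4 * n \<le> N" by linarith
    then have "int N + 1 - 4 * int n = int (N - 4 * n) + 1" by simp
    then have sr: "sine_ratio x (int N + 1 - 4 * int n) = gegenbauer 1 (N - 4 * n) x"
      by (simp only: sine_ratio_Suc)
    have "real (N - 4 * n) / 2 + 3 / 2 + real n = (real N + 3) / 2 - real n"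
      using le by (simp add: of_nat_diff field_simps)
    then show ?thesis
      using le unfolding kernel_double_term_def prod.case sr ph[OF n]
      by (simp add: bessel_weight_def of_nat_diff field_simps)
  qed
  have "(\<Sum>n\<le>N div 4. kernel_double_term z x (N - 4 * n, n)) =
    (\<Sum>n\<le>N div 4. phase ^ N / 2 * of_real ((z / 2) ^ N) *
      of_real (bessel_weight N n * sine_ratio x (int N + 1 - 4 * int n)))"
    by (intro sum.cong refl antidiagonal) simp
  also have "\<dots> = phase ^ N / 2 * of_real ((z / 2) ^ N) * of_real (angular_coeff x N)"
    unfolding angular_coeff_def of_real_sum sum_distrib_left ..
  finally show ?thesis
    by (simp add: kernel_coeff_def power_divide)
qed

text \<open>Summing the absolutely summable family first over \<open>n\<close> gives the kernel as defined; summing it along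
  \<open>4n + k = N\<close> gives the power series.\<close>

lemma rdf_kernel_power_series:
  assumes "z > 0"
  shows rdf_term_summable: "summable (rdf_term 4 4 z x)"
    and rdf_kernel_sums: "(\<lambda>N. kernel_coeff x N * of_real z ^ N) sums rdf_kernel 4 4 z x"
proof -
  define S where "S = infsum (kernel_double_term z x) (UNIV \<times> UNIV)"
  have total: "(kernel_double_term z x has_sum S) (UNIV \<times> UNIV)"
    using kernel_double_term_summable[OF assms, of x] by (simp add: S_def)
  have "(rdf_term 4 4 z x has_sum S) UNIV"
    using has_sum_SigmaD[OF total] kernel_double_term_sums_rdf_term[OF assms, of x] by blast
  then have by_order: "rdf_term 4 4 z x sums S"
    by (rule has_sum_imp_sums)
  then show "summable (rdf_term 4 4 z x)"
    by (rule sums_summable)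
  have "((\<lambda>(N, n). kernel_double_term z x (N - 4 * n, n)) has_sum S) (Sigma UNIV (\<lambda>N. {..N div 4}))"
    using total
    by (subst has_sum_reindex_bij_witness[where T = "UNIV \<times> UNIV" and h = "kernel_double_term z x" and
        i = "\<lambda>(k, n). (4 * n + k, n)" and j = "\<lambda>(N, n). (N - 4 * n, n)"]) auto
  then have "((\<lambda>N. \<Sum>n\<le>N div 4. kernel_double_term z x (N - 4 * n, n)) has_sum S) UNIV"
    by (rule has_sum_SigmaD) (auto intro!: has_sum_finiteI)
  then have "(\<lambda>N. of_real (sqrt pi) * (\<Sum>n\<le>N div 4. kernel_double_term z x (N - 4 * n, n)))
      sums (of_real (sqrt pi) * S)"
    by (intro sums_mult has_sum_imp_sums)
  moreover have "rdf_kernel 4 4 z x = of_real (sqrt pi) * S"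
  proof -
    have "inverse (rGamma (3 / 2 :: real)) = sqrt pi / 2"
      using rGamma_three_halves[of 0] by simp
    then have "4 powr (1 / 2) * Gamma (3 / 2) = sqrt pi"
      by (simp add: rGamma_inverse_Gamma powr_half_sqrt)
    moreover have "rdf_kernel 4 4 z x = of_real (4 powr (1 / 2) * Gamma (3 / 2)) * suminf (rdf_term 4 4 z x)"
      by (simp add: rdf_kernel_def rdf_lambda_def)
    ultimately show ?thesis
      using by_order by (simp only: sums_iff)
  qed
  ultimately show "(\<lambda>N. kernel_coeff x N * of_real z ^ N) sums rdf_kernel 4 4 z x"
    by (simp add: sum_kernel_double_term_antidiagonal)
qed

section \<open>The Fresnel integral\<close>

lemma integral_gaussian_at_top:
  "((\<lambda>r. integral {0..r} (\<lambda>s. exp (- s\<^sup>2))) \<longlongrightarrow> sqrt pi / 2) (at_top :: real filter)"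
proof -
  let ?f = "\<lambda>x::real. indicator {0..} x *\<^sub>R exp (- x\<^sup>2)"
  have int: "integrable lborel ?f" and val: "(\<integral>x. ?f x \<partial>lborel) = sqrt pi / 2"
    using gaussian_moment_0 by (simp_all add: has_bochner_integral_iff)
  have "(\<integral>x. indicator {..r} x *\<^sub>R ?f x \<partial>lborel) = integral {0..r} (\<lambda>s. exp (- s\<^sup>2))" for r
  proof -
    have "set_integrable lborel {0..r} (\<lambda>s. exp (- s\<^sup>2))"
      by (intro borel_integrable_atLeastAtMost' continuous_intros)
    then have "integral {0..r} (\<lambda>s. exp (- s\<^sup>2)) = (LINT s:{0..r}|lborel. exp (- s\<^sup>2))"
      using set_borel_integral_eq_integral(2) by metis
    also have "\<dots> = (\<integral>x. indicator {..r} x *\<^sub>R ?f x \<partial>lborel)"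
      unfolding set_lebesgue_integral_def
      by (intro Bochner_Integration.integral_cong) (auto simp: indicator_def)
    finally show ?thesis ..
  qed
  then show ?thesis
    using tendsto_integral_at_top[OF sets_lborel int] unfolding val by simp
qed

lemma exp_i_square_primitive:
  obtains P where "\<And>w. (P has_field_derivative exp (\<i> * w\<^sup>2)) (at w)" "P 0 = 0"
proof -
  have "(\<lambda>w. exp (\<i> * w\<^sup>2)) holomorphic_on UNIV"
    by (intro holomorphic_intros)
  then obtain Q where Q: "\<And>w. (Q has_field_derivative exp (\<i> * w\<^sup>2)) (at w)"
    using holomorphic_convex_primitive'[OF convex_UNIV open_UNIV] by (metis UNIV_I)
  show ?thesis
  proof
    show "((\<lambda>w. Q w - Q 0) has_field_derivative exp (\<i> * w\<^sup>2)) (at w)" for w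
      by (auto intro!: derivative_eq_intros Q)
  qed simp
qed

lemma fresnel_primitive_odd:
  assumes P: "\<And>w. (P has_field_derivative exp (\<i> * w\<^sup>2)) (at w)" and P0: "P 0 = 0"
  shows "P (- w) = - P w"
proof -
  have "((\<lambda>w. P w + P (- w)) has_field_derivative 0) (at w within UNIV)" for w
    by (rule derivative_eq_intros DERIV_chain2[OF P] P | simp)+
  then obtain c where "\<And>w. P w + P (- w) = c"
    using has_field_derivative_zero_constant[OF convex_UNIV] by (metis UNIV_I)
  from this[of w] this[of 0] show ?thesis
    by (simp add: P0 eq_neg_iff_add_eq_0 add.commute)
qed

lemma cis_pi_quarter_power2: "cis (pi / 4) ^ 2 = \<i>"
  by (simp add: complex_eq_iff power2_eq_square cos_45 sin_45)

text \<open>On the ray of argument \<open>\<pi> / 4\<close> the integrand becomes the Gaussian function, because the square of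
  \<open>cis (\<pi> / 4)\<close> is \<open>\<i>\<close>.\<close>

lemma fresnel_primitive_diagonal:
  assumes P: "\<And>w. (P has_field_derivative exp (\<i> * w\<^sup>2)) (at w)" and P0: "P 0 = 0" and r: "0 \<le> r"
  shows "P (of_real r * cis (pi / 4)) = cis (pi / 4) * of_real (integral {0..r} (\<lambda>s. exp (- s\<^sup>2)))"
proof -
  have "((\<lambda>s. P (of_real s * cis (pi / 4))) has_vector_derivative
      cis (pi / 4) * exp (\<i> * (of_real s * cis (pi / 4))\<^sup>2)) (at s within {0..r})" for s
    by (rule field_vector_diff_chain_within[unfolded o_def, OF _ DERIV_subset[OF P subset_UNIV]])
      (auto intro!: derivative_eq_intros has_vector_derivative_of_real)
  moreover have "\<i> * (of_real s * cis (pi / 4))\<^sup>2 = of_real (- s\<^sup>2)" for s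
    by (simp add: power_mult_distrib cis_pi_quarter_power2 complex_eq_iff flip: of_real_power)
  ultimately have "((\<lambda>s. cis (pi / 4) * of_real (exp (- s\<^sup>2))) has_integral
      (P (of_real r * cis (pi / 4)) - P (of_real 0 * cis (pi / 4)))) {0..r}"
    by (intro fundamental_theorem_of_calculus r) (simp only: exp_of_real)
  moreover have "((\<lambda>s. cis (pi / 4) * of_real (exp (- s\<^sup>2))) has_integral
      cis (pi / 4) * of_real (integral {0..r} (\<lambda>s. exp (- s\<^sup>2)))) {0..r}"
    by (intro has_integral_mult_right has_integral_of_real integrable_integral
      integrable_continuous_interval continuous_intros)
  ultimately have "P (of_real r * cis (pi / 4)) - P (of_real 0 * cis (pi / 4)) =
      cis (pi / 4) * of_real (integral {0..r} (\<lambda>s. exp (- s\<^sup>2)))"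
    by (rule has_integral_unique)
  then show ?thesis
    by (simp add: P0)
qed

text \<open>The modulus of \<open>exp (\<i> w\<^sup>2)\<close> at \<open>w = R + \<i> y\<close> is \<open>exp (- 2 R y)\<close>, so the third side of the
  triangle with corners \<open>0\<close>, \<open>R\<close> and \<open>R + \<i> R\<close> contributes a vanishing amount.\<close>

lemma fresnel_primitive_vertical_bound:
  assumes P: "\<And>w. (P has_field_derivative exp (\<i> * w\<^sup>2)) (at w)" and R: "0 < R"
  shows "norm (P (of_real R + \<i> * of_real R) - P (of_real R)) \<le> 1 / (2 * R)"
proof -
  have "((\<lambda>y. P (of_real R + \<i> * of_real y)) has_vector_derivative
      \<i> * exp (\<i> * (of_real R + \<i> * of_real y)\<^sup>2)) (at y within {0..R})" for y
    by (rule field_vector_diff_chain_within[unfolded o_def, OF _ DERIV_subset[OF P subset_UNIV]])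
      (auto intro!: derivative_eq_intros has_vector_derivative_of_real)
  then have main: "((\<lambda>y. \<i> * exp (\<i> * (of_real R + \<i> * of_real y)\<^sup>2)) has_integral
      (P (of_real R + \<i> * of_real R) - P (of_real R))) {0..R}"
    using fundamental_theorem_of_calculus[of 0 R "\<lambda>y. P (of_real R + \<i> * of_real y)"] R by simp
  have "((\<lambda>y. exp (- 2 * R * y)) has_integral
      (- exp (- 2 * R * R) / (2 * R) - (- exp (- 2 * R * 0) / (2 * R)))) {0..R}"
    using R by (intro fundamental_theorem_of_calculus)
      (auto intro!: derivative_eq_intros simp flip: has_real_derivative_iff_has_vector_derivative)
  then have bound: "((\<lambda>y. exp (- 2 * R * y)) has_integral (1 - exp (- 2 * R * R)) / (2 * R)) {0..R}"
    by (simp add: diff_divide_distrib)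
  have "norm (\<i> * exp (\<i> * (of_real R + \<i> * of_real y)\<^sup>2)) = exp (- 2 * R * y)" for y
    by (simp add: norm_mult power2_eq_square algebra_simps)
  then have "norm (P (of_real R + \<i> * of_real R) - P (of_real R)) \<le> (1 - exp (- 2 * R * R)) / (2 * R)"
    by (intro integral_norm_bound_integral[OF has_integral_integrable[OF main]
      has_integral_integrable[OF bound], unfolded integral_unique[OF main] integral_unique[OF bound]] eq_refl)
  also have "\<dots> \<le> 1 / (2 * R)"
    using R by (simp add: divide_right_mono)
  finally show ?thesis .
qed

text \<open>A primitive makes the contour shift a mere comparison of its values at \<open>R\<close> and at \<open>R + \<i> R\<close>, the point
  of modulus \<open>sqrt 2 * R\<close> on the diagonal ray.\<close>

lemma fresnel_primitive_at_top:
  assumes P: "\<And>w. (P has_field_derivative exp (\<i> * w\<^sup>2)) (at w)" and P0: "P 0 = 0"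
  shows "((\<lambda>r. P (of_real r)) \<longlongrightarrow> cis (pi / 4) * of_real (sqrt pi / 2)) (at_top :: real filter)"
proof -
  have corner: "of_real R + \<i> * of_real R = of_real (sqrt 2 * R) * cis (pi / 4)" for R
    by (simp add: complex_eq_iff cos_45 sin_45)
  have sc: "filterlim (\<lambda>R. sqrt 2 * R) at_top (at_top :: real filter)"
    by (rule filterlim_tendsto_pos_mult_at_top[OF tendsto_const _ filterlim_ident]) simp
  have diagonal: "((\<lambda>R. P (of_real R + \<i> * of_real R)) \<longlongrightarrow> cis (pi / 4) * of_real (sqrt pi / 2)) at_top"
  proof (rule Lim_transform_eventually)
    show "((\<lambda>R. cis (pi / 4) * of_real (integral {0..sqrt 2 * R} (\<lambda>s. exp (- s\<^sup>2))))
        \<longlongrightarrow> cis (pi / 4) * of_real (sqrt pi / 2)) at_top"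
      by (intro tendsto_intros filterlim_compose[OF integral_gaussian_at_top sc])
    show "\<forall>\<^sub>F R in at_top. cis (pi / 4) * of_real (integral {0..sqrt 2 * R} (\<lambda>s. exp (- s\<^sup>2)))
        = P (of_real R + \<i> * of_real R)"
      using eventually_ge_at_top[of 0]
      by eventually_elim (simp only: corner, subst fresnel_primitive_diagonal[OF P P0], auto)
  qed
  have "((\<lambda>R. 1 / (2 * R)) \<longlongrightarrow> 0) (at_top :: real filter)"
    by real_asymp
  then have "((\<lambda>R. P (of_real R + \<i> * of_real R) - P (of_real R)) \<longlongrightarrow> 0) at_top"
  proof (rule Lim_null_comparison[rotated])
    show "\<forall>\<^sub>F R in at_top. norm (P (of_real R + \<i> * of_real R) - P (of_real R)) \<le> 1 / (2 * R)"
      using eventually_gt_at_top[of 0] by eventually_elim (rule fresnel_primitive_vertical_bound[OF P])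
  qed
  from tendsto_diff[OF diagonal this] show ?thesis by simp
qed

text \<open>The primitive is odd, so its limit at \<open>-\<infinity>\<close> is the negative of its limit at \<open>\<infinity>\<close>.\<close>

lemma fresnel_has_integral:
  assumes P: "\<And>w. (P has_field_derivative exp (\<i> * w\<^sup>2)) (at w)" and P0: "P 0 = 0"
  shows "((\<lambda>t. exp (\<i> * of_real (t ^ 2))) has_integral
    (P (of_real u) + cis (pi / 4) * of_real (sqrt pi / 2))) {..u}"
proof -
  have int: "((\<lambda>t. exp (\<i> * of_real (t ^ 2))) has_integral (P (of_real u) - P (of_real b))) {b..u}"
    if "b \<le> u" for b
  proof (rule fundamental_theorem_of_calculus[OF that])
    show "((\<lambda>t. P (of_real t)) has_vector_derivative exp (\<i> * of_real (t ^ 2))) (at t within {b..u})" for t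
      using field_vector_diff_chain_within[OF has_vector_derivative_of_real[OF DERIV_ident] DERIV_subset[OF P subset_UNIV], of t]
      by (simp add: o_def)
  qed
  have "((\<lambda>b. P (of_real (- b))) \<longlongrightarrow> cis (pi / 4) * of_real (sqrt pi / 2)) (at_bot :: real filter)"
    by (rule filterlim_compose[OF fresnel_primitive_at_top[OF P P0] filterlim_uminus_at_top_at_bot])
  then have "((\<lambda>b. P (of_real u) + P (of_real (- b)))
      \<longlongrightarrow> P (of_real u) + cis (pi / 4) * of_real (sqrt pi / 2)) (at_bot :: real filter)"
    by (intro tendsto_intros)
  moreover have "P (of_real u) + P (of_real (- b)) = integral {b..u} (\<lambda>t. exp (\<i> * of_real (t ^ 2)))"
    if "b \<le> u" for b
    unfolding integral_unique[OF int[OF that]] by (simp add: fresnel_primitive_odd[OF P P0])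
  then have "\<forall>\<^sub>F b in at_bot. P (of_real u) + P (of_real (- b)) =
      integral {b..u} (\<lambda>t. exp (\<i> * of_real (t ^ 2)))"
    using eventually_le_at_bot[of u] by (rule eventually_mono[rotated])
  ultimately have "((\<lambda>b. integral {b..u} (\<lambda>t. exp (\<i> * of_real (t ^ 2))))
      \<longlongrightarrow> P (of_real u) + cis (pi / 4) * of_real (sqrt pi / 2)) at_bot"
    by (rule Lim_transform_eventually)
  then show ?thesis
    by (subst has_integral_atMost_iff_improper)
      (auto intro!: integrable_continuous_interval continuous_intros)
qed

section \<open>The differential equation in the radial variable\<close>

text \<open>Euler's equation \<open>w E' = E\<close> makes \<open>E w / w\<close> locally constant on the punctured plane, which is
  connected; hence \<open>E\<close> is linear and its slope is \<open>E' 0\<close>.\<close>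

lemma homogeneous_degree_one_eq_0:
  fixes E :: "complex \<Rightarrow> complex"
  assumes E: "\<And>w. (E has_field_derivative E' w) (at w)"
    and euler: "\<And>w. w * E' w = E w" and "E' 0 = 0"
  shows "E w = 0"
proof -
  have "((\<lambda>w. E w / w) has_field_derivative 0) (at w)" if "w \<noteq> 0" for w
    using that euler[of w] by (auto intro!: derivative_eq_intros E simp: field_simps)
  moreover have "continuous_on (- {0}) (\<lambda>w. E w / w)"
    using E by (intro continuous_intros DERIV_continuous_on[where D = E'])
      (auto intro: has_field_derivative_at_within)
  ultimately obtain c where c: "\<And>w. w \<in> - {0} \<Longrightarrow> E w / w = c"
    using DERIV_zero_connected_constant[of "- {0}" "{}" "\<lambda>w. E w / w"] connected_punctured_universe[of "0 :: complex"]
    by auto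
  have lin: "E = (\<lambda>w. c * w)"
  proof
    show "E w = c * w" for w
      using c[of w] euler[of 0] by (cases "w = 0") (auto simp: field_simps)
  qed
  have "(E has_field_derivative c) (at 0)"
    unfolding lin by (auto intro!: derivative_eq_intros)
  then have "c = 0"
    using DERIV_unique[OF E[of 0]] assms(3) by simp
  then show ?thesis by (simp add: lin)
qed

definition kernel_entire :: "real \<Rightarrow> complex \<Rightarrow> complex" where
  "kernel_entire x w = (\<Sum>N. kernel_coeff x N * w ^ N)"

lemma kernel_coeff_summable: "summable (\<lambda>N. kernel_coeff x N * w ^ N)"
proof (rule powser_inside)
  have pos: "norm w + 1 > 0" by (simp add: add_nonneg_pos)
  show "summable (\<lambda>N. kernel_coeff x N * of_real (norm w + 1) ^ N)"
    by (rule sums_summable[OF rdf_kernel_sums[OF pos]])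
  show "norm w < norm (of_real (norm w + 1) :: complex)"
    unfolding norm_of_real using pos by linarith
qed

lemma kernel_entire_sums: "(\<lambda>N. kernel_coeff x N * w ^ N) sums kernel_entire x w"
  unfolding kernel_entire_def by (rule summable_sums[OF kernel_coeff_summable])

lemma rdf_kernel_eq_kernel_entire: "z > 0 \<Longrightarrow> rdf_kernel 4 4 z x = kernel_entire x (of_real z)"
  using sums_unique2[OF rdf_kernel_sums kernel_entire_sums] .

lemma exp_even_powers_sums:
  "(\<lambda>M. if even M then (\<i> / 2) ^ (M div 2 + 1) / fact (M div 2 + 1) * w ^ (M + 2) else 0)
    sums (exp (\<i> * w\<^sup>2 / 2) - 1)"
proof -
  have "(\<lambda>j. y ^ j / fact j) sums exp y" for y :: complex
    using exp_converges[of y] by (simp add: scaleR_conv_of_real divide_inverse mult.commute)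
  from sums_split_initial_segment[OF this[of "\<i> * w\<^sup>2 / 2"], of 1]
  have "(\<lambda>j. (\<i> * w\<^sup>2 / 2) ^ (j + 1) / fact (j + 1)) sums (exp (\<i> * w\<^sup>2 / 2) - 1)"
    by simp
  moreover have "(\<i> * w\<^sup>2 / 2) ^ (j + 1) / fact (j + 1) =
      (\<i> / 2) ^ (2 * j div 2 + 1) / fact (2 * j div 2 + 1) * w ^ (2 * j + 2)" for j
  proof -
    have "2 * j + 2 = 2 * (j + 1)" by simp
    then have "w ^ (2 * j + 2) = (w\<^sup>2) ^ (j + 1)" by (simp only: power_mult)
    moreover have "(\<i> * w\<^sup>2 / 2) ^ (j + 1) = (\<i> / 2) ^ (j + 1) * (w\<^sup>2) ^ (j + 1)"
      by (simp flip: power_mult_distrib)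
    ultimately show ?thesis by simp
  qed
  ultimately have "(\<lambda>j. (\<i> / 2) ^ (2 * j div 2 + 1) / fact (2 * j div 2 + 1) * w ^ (2 * j + 2))
      sums (exp (\<i> * w\<^sup>2 / 2) - 1)"
    by (simp only:)
  then have "(\<lambda>j. if even (2 * j) then (\<i> / 2) ^ (2 * j div 2 + 1) / fact (2 * j div 2 + 1) * w ^ (2 * j + 2)
      else 0) sums (exp (\<i> * w\<^sup>2 / 2) - 1)"
    by (simp only: dvd_triv_left if_True)
  then show ?thesis
    by (subst (asm) sums_mono_reindex[where g = "\<lambda>j. 2 * j"]) (auto simp: strict_mono_def elim!: evenE)
qed

text \<open>The recurrence for the coefficients, multiplied by \<open>w ^ (M + 2)\<close> and summed. The two coefficients it does
  not determine enter separately: \<open>kernel_coeff x 0 = 1\<close> supplies the constant term of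
  \<open>exp (\<i> w\<^sup>2 / 2)\<close>, and \<open>kernel_coeff x 1\<close> drops out of \<open>w D w - h w\<close>, so it has to be
  recorded as an initial condition.\<close>

lemma kernel_entire_ode:
  obtains D where "\<And>w. (kernel_entire x has_field_derivative D w) (at w)"
    and "\<And>w. w * D w = (1 - \<i> * of_real (2 * x\<^sup>2 - 1) * w\<^sup>2) * kernel_entire x w - exp (\<i> * w\<^sup>2 / 2)"
    and "D 0 = kernel_coeff x 1"
proof
  define D where "D = (\<lambda>w. \<Sum>N. diffs (kernel_coeff x) N * w ^ N)"
  show "(kernel_entire x has_field_derivative D w) (at w)" for w
    unfolding kernel_entire_def[abs_def] D_def
    by (rule termdiffs_strong_converges_everywhere[OF kernel_coeff_summable])
  show "D 0 = kernel_coeff x 1"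
    by (simp add: D_def powser_zero diffs_def)
  fix w
  let ?c = "kernel_coeff x" and ?h = "kernel_entire x w"
  have "(\<lambda>N. diffs ?c N * w ^ N) sums D w"
    unfolding D_def by (intro summable_sums termdiff_converges_all kernel_coeff_summable)
  then have "(\<lambda>N. w * (diffs ?c N * w ^ N)) sums (w * D w)"
    by (rule sums_mult)
  then have "(\<lambda>N. of_nat (Suc N) * ?c (Suc N) * w ^ Suc N) sums (w * D w)"
    by (simp add: diffs_def mult_ac)
  then have "(\<lambda>N. of_nat N * ?c N * w ^ N) sums (w * D w)"
    using sums_Suc_iff[of "\<lambda>N. of_nat N * ?c N * w ^ N"] by simp
  from sums_diff[OF this kernel_entire_sums]
  have "(\<lambda>N. of_nat N * ?c N * w ^ N - ?c N * w ^ N) sums (w * D w - ?h)" .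
  from sums_split_initial_segment[OF this, of 2]
  have "(\<lambda>M. of_nat (M + 2) * ?c (M + 2) * w ^ (M + 2) - ?c (M + 2) * w ^ (M + 2)) sums (w * D w - ?h + 1)"
    by (simp add: lessThan_nat_numeral kernel_coeff_0 del: add_2_eq_Suc')
  then have lhs: "(\<lambda>M. of_nat (M + 1) * ?c (M + 2) * w ^ (M + 2)) sums (w * D w - ?h + 1)"
    by (simp add: algebra_simps)
  have "(\<lambda>M. - \<i> * of_real (2 * x\<^sup>2 - 1) * w\<^sup>2 * (?c M * w ^ M) -
      (if even M then (\<i> / 2) ^ (M div 2 + 1) / fact (M div 2 + 1) * w ^ (M + 2) else 0))
    sums (- \<i> * of_real (2 * x\<^sup>2 - 1) * w\<^sup>2 * ?h - (exp (\<i> * w\<^sup>2 / 2) - 1))"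
    by (intro sums_diff sums_mult kernel_entire_sums exp_even_powers_sums)
  also have "(\<lambda>M. - \<i> * of_real (2 * x\<^sup>2 - 1) * w\<^sup>2 * (?c M * w ^ M) -
      (if even M then (\<i> / 2) ^ (M div 2 + 1) / fact (M div 2 + 1) * w ^ (M + 2) else 0)) =
    (\<lambda>M. of_nat (M + 1) * ?c (M + 2) * w ^ (M + 2))"
    unfolding kernel_coeff_rec by (auto simp: algebra_simps power_add power2_eq_square)
  finally have "w * D w - ?h + 1 = - \<i> * of_real (2 * x\<^sup>2 - 1) * w\<^sup>2 * ?h - (exp (\<i> * w\<^sup>2 / 2) - 1)"
    using lhs sums_unique2 by blast
  then show "w * D w = (1 - \<i> * of_real (2 * x\<^sup>2 - 1) * w\<^sup>2) * ?h - exp (\<i> * w\<^sup>2 / 2)"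
    by (simp add: algebra_simps)
qed

text \<open>Multiplying the difference of the two sides by the integrating factor \<open>exp (\<i> c w\<^sup>2 / 2)\<close>, where
  \<open>c = 2 x\<^sup>2 - 1\<close>, turns the differential equation into Euler's equation. The initial condition
  \<open>E' 0 = 0\<close> is where the value of the Fresnel integral is needed.\<close>

lemma kernel_entire_closed_form:
  assumes P: "\<And>w. (P has_field_derivative exp (\<i> * w\<^sup>2)) (at w)" and P0: "P 0 = 0"
  shows "kernel_entire x w = exp (\<i> * w\<^sup>2 / 2) - 2 * \<i> * of_real x * w *
    exp (- (\<i> * of_real (2 * x\<^sup>2 - 1) * w\<^sup>2 / 2)) *
    (P (of_real x * w) + cis (pi / 4) * of_real (sqrt pi / 2))"
proof -
  define L where "L = cis (pi / 4) * of_real (sqrt pi / 2)"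
  define c :: complex where "c = of_real (2 * x\<^sup>2 - 1)"
  define X :: complex where "X = of_real x"
  have cX: "c = 2 * X\<^sup>2 - 1" by (simp add: c_def X_def)
  obtain D where D: "\<And>w. (kernel_entire x has_field_derivative D w) (at w)"
    and ode: "\<And>w. w * D w = (1 - \<i> * c * w\<^sup>2) * kernel_entire x w - exp (\<i> * w\<^sup>2 / 2)"
    and D0: "D 0 = kernel_coeff x 1"
    by (rule kernel_entire_ode[of x, folded c_def]) (rule that)
  \<comment> \<open>The difference of both sides times the integrating factor; the exponentials on the closed-form side
    simplify by the fact \<open>split\<close> below.\<close>
  define E where "E = (\<lambda>w. kernel_entire x w * exp (\<i> * c * w\<^sup>2 / 2) - exp (\<i> * (X * w)\<^sup>2) +
    2 * \<i> * X * w * (P (X * w) + L))"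
  define E' where "E' = (\<lambda>w. (D w + \<i> * c * w * kernel_entire x w) * exp (\<i> * c * w\<^sup>2 / 2) +
    2 * \<i> * X * (P (X * w) + L))"
  have split: "exp (\<i> * w\<^sup>2 / 2) * exp (\<i> * c * w\<^sup>2 / 2) = exp (\<i> * (X * w)\<^sup>2)" for w
  proof -
    have "\<i> * w\<^sup>2 / 2 + \<i> * c * w\<^sup>2 / 2 = \<i> * (X * w)\<^sup>2"
      by (simp add: cX power_mult_distrib field_simps)
    then show ?thesis by (simp only: exp_add [symmetric])
  qed
  have "E w = 0"
  proof (rule homogeneous_degree_one_eq_0[where E = E and E' = E'])
    show "(E has_field_derivative E' w) (at w)" for w
    proof -
      have "((\<lambda>w. P (X * w)) has_field_derivative exp (\<i> * (X * w)\<^sup>2) * X) (at w)"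
        by (rule DERIV_chain2[OF P]) (auto intro!: derivative_eq_intros)
      then show ?thesis
        unfolding E_def E'_def
        by (auto intro!: derivative_eq_intros D simp: algebra_simps power2_eq_square)
    qed
    show "w * E' w = E w" for w
    proof -
      have "w * E' w = (w * D w + \<i> * c * w\<^sup>2 * kernel_entire x w) * exp (\<i> * c * w\<^sup>2 / 2) +
          2 * \<i> * X * w * (P (X * w) + L)"
        by (simp add: E'_def algebra_simps power2_eq_square)
      also have "w * D w + \<i> * c * w\<^sup>2 * kernel_entire x w = kernel_entire x w - exp (\<i> * w\<^sup>2 / 2)"
        by (simp add: ode algebra_simps)
      finally show ?thesis
        unfolding E_def split [symmetric] by (simp add: algebra_simps)
    qed
    have "phase + \<i> * cis (pi / 4) = 0"
      by (simp add: phase_def cis_conv_exp [symmetric] complex_eq_iff cos_45 sin_45)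
        (simp add: exp_eq_polar cis.ctr cos_45 sin_45)
    then have "of_real (sqrt pi) * X * (phase + \<i> * cis (pi / 4)) = 0" by simp
    then show "E' 0 = 0"
      unfolding E'_def D0 kernel_coeff_1 by (simp add: P0 L_def X_def algebra_simps)
  qed
  then have "kernel_entire x w * exp (\<i> * c * w\<^sup>2 / 2) =
      exp (\<i> * w\<^sup>2 / 2) * exp (\<i> * c * w\<^sup>2 / 2) - 2 * \<i> * X * w * (P (X * w) + L)"
    unfolding split by (simp add: E_def algebra_simps)
  then have "kernel_entire x w = (exp (\<i> * w\<^sup>2 / 2) * exp (\<i> * c * w\<^sup>2 / 2) -
      2 * \<i> * X * w * (P (X * w) + L)) * exp (- (\<i> * c * w\<^sup>2 / 2))"
    by (simp add: exp_minus field_simps)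
  also have "\<dots> = exp (\<i> * w\<^sup>2 / 2) - 2 * \<i> * X * w * exp (- (\<i> * c * w\<^sup>2 / 2)) * (P (X * w) + L)"
    by (simp add: exp_minus field_simps)
  finally show ?thesis
    unfolding c_def X_def L_def .
qed

theorem theorem2p4:
  shows "(\<forall>z \<theta> \<xi> :: real. z > 0 \<longrightarrow> \<theta> \<in> {0..pi} \<longrightarrow> \<xi> = cos \<theta> \<longrightarrow>
      summable (rdf_term 4 4 z \<xi>) \<and>
      (\<lambda>t. exp (\<i> * complex_of_real (t ^ 2))) integrable_on {..z * \<xi>} \<and>
      rdf_kernel 4 4 z \<xi> =
        exp (- \<i> * complex_of_real (z ^ 2 * (\<xi> ^ 2 - 1 / 2))) *
        (- 2 * \<i> * complex_of_real (z * \<xi>) *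
            integral {..z * \<xi>} (\<lambda>t. exp (\<i> * complex_of_real (t ^ 2))) +
          exp (\<i> * complex_of_real (z ^ 2 * \<xi> ^ 2))) \<and>
      rdf_kernel 4 4 z \<xi> =
        exp (\<i> * complex_of_real (z ^ 2 / 2)) -
        2 * \<i> * complex_of_real (z * cos \<theta>) *
          exp (- (\<i> / 2) * complex_of_real (z ^ 2 * cos (2 * \<theta>))) *
          integral {..z * cos \<theta>} (\<lambda>t. exp (\<i> * complex_of_real (t ^ 2)))) \<and>
    (\<lambda>z. rdf_kernel 4 4 z 1) \<in> O[at_top](\<lambda>z. complex_of_real z)"
proof (intro conjI allI impI)
  obtain P where P: "\<And>w. (P has_field_derivative exp (\<i> * w\<^sup>2)) (at w)" and P0: "P 0 = 0"
    using exp_i_square_primitive by blast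
  define L where "L = cis (pi / 4) * of_real (sqrt pi / 2)"
  note fresnel = fresnel_has_integral[OF P P0, folded L_def]
  have closed: "rdf_kernel 4 4 z x = exp (\<i> * of_real (z\<^sup>2 / 2)) - 2 * \<i> * of_real (z * x) *
      exp (- (\<i> * of_real (z\<^sup>2 * (x\<^sup>2 - 1 / 2)))) * (P (of_real (z * x)) + L)"
    if "z > 0" for z x
    unfolding rdf_kernel_eq_kernel_entire[OF that] kernel_entire_closed_form[OF P P0] L_def
    by (simp add: algebra_simps diff_divide_distrib)
  {
    fix z \<theta> \<xi> :: real
    assume z: "z > 0" and \<xi>: "\<xi> = cos \<theta>"
    show "summable (rdf_term 4 4 z \<xi>)"
      using z by (rule rdf_term_summable)
    show "(\<lambda>t. exp (\<i> * complex_of_real (t ^ 2))) integrable_on {..z * \<xi>}"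
      using fresnel by (rule has_integral_integrable)
    have "exp (- \<i> * complex_of_real (z ^ 2 * (\<xi> ^ 2 - 1 / 2))) * exp (\<i> * complex_of_real (z ^ 2 * \<xi> ^ 2)) =
        exp (\<i> * of_real (z\<^sup>2 / 2))"
      by (simp add: algebra_simps flip: exp_add)
    then show "rdf_kernel 4 4 z \<xi> =
        exp (- \<i> * complex_of_real (z ^ 2 * (\<xi> ^ 2 - 1 / 2))) *
        (- 2 * \<i> * complex_of_real (z * \<xi>) *
            integral {..z * \<xi>} (\<lambda>t. exp (\<i> * complex_of_real (t ^ 2))) +
          exp (\<i> * complex_of_real (z ^ 2 * \<xi> ^ 2)))"
      unfolding closed[OF z] integral_unique[OF fresnel] distrib_left by simp
    have "\<i> * of_real (z\<^sup>2 * ((cos \<theta>)\<^sup>2 - 1 / 2)) = \<i> / 2 * complex_of_real (z ^ 2 * cos (2 * \<theta>))"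
      unfolding cos_double_cos by (simp add: algebra_simps)
    then show "rdf_kernel 4 4 z \<xi> =
        exp (\<i> * complex_of_real (z ^ 2 / 2)) -
        2 * \<i> * complex_of_real (z * cos \<theta>) *
          exp (- (\<i> / 2) * complex_of_real (z ^ 2 * cos (2 * \<theta>))) *
          integral {..z * cos \<theta>} (\<lambda>t. exp (\<i> * complex_of_real (t ^ 2)))"
      unfolding closed[OF z] integral_unique[OF fresnel] \<xi> by (simp only: mult_minus_left)
  }
  have "((\<lambda>z. P (of_real z) + L) \<longlongrightarrow> L + L) (at_top :: real filter)"
    using fresnel_primitive_at_top[OF P P0] unfolding L_def by (intro tendsto_intros)
  then have "\<forall>\<^sub>F z in at_top. norm (P (of_real z) + L) < norm (L + L) + 1"
    by (intro order_tendstoD(2)[OF tendsto_norm]) auto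
  then have "\<forall>\<^sub>F z in at_top. norm (rdf_kernel 4 4 z 1) \<le> (1 + 2 * (norm (L + L) + 1)) * norm (complex_of_real z)"
    using eventually_ge_at_top[of 1]
  proof eventually_elim
    case (elim z)
    then have pos: "z > 0" by simp
    have "norm (rdf_kernel 4 4 z 1) \<le> norm (exp (\<i> * complex_of_real (z\<^sup>2 / 2))) +
       norm (2 * \<i> * complex_of_real (z * 1) *
        exp (- (\<i> * complex_of_real (z\<^sup>2 * (1\<^sup>2 - 1 / 2)))) * (P (of_real (z * 1)) + L))"
      unfolding closed[OF pos] by (rule norm_triangle_ineq4)
    also have "\<dots> = 1 + 2 * z * norm (P (of_real z) + L)"
      using elim by (simp add: norm_mult)
    also have "\<dots> \<le> z + 2 * z * (norm (L + L) + 1)"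
      using elim by (intro add_mono mult_left_mono) auto
    finally show ?case using elim by (simp add: algebra_simps)
  qed
  then show "(\<lambda>z. rdf_kernel 4 4 z 1) \<in> O[at_top](\<lambda>z. complex_of_real z)"
    by (rule landau_o.bigI[rotated]) (simp add: add_pos_nonneg)
qed

end
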